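(* Let $\Lambda$ be (the vertex set of) a finite graph with edge set $E$, let $\mathbf{J} = \{J_e\}_{e\in E}$ be real two-site coupling coefficients and $\mathbf{h} = \{h_x\}_{x\in\Lambda}$ real site-dependent external fields, both of possibly arbitrary signs. Then for any two sites $i,j\in\Lambda$, $$\left|\operatorname{cov}_{\mathbf{J},\mathbf{h}}(\sigma_i,\sigma_j)\right| \le \operatorname{cov}_{|\mathbf{J}|,|\mathbf{h}|}(\sigma_i,\sigma_j) \left( \frac{Z_{|\mathbf{J}|,|\mathbf{h}|}}{Z_{\mathbf{J},\mathbf{h}}} \right)^2 .$$
   Context: For a finite graph with vertex set $\Lambda$ and edge set $E$, and real parameters $\mathbf{J}=\{J_e\}_{e\in E}$, $\mathbf{h}=\{h_x\}_{x\in\Lambda}$, the Ising Hamiltonian is $$H_{\mathbf{J},\mathbf{h}}(\boldsymbol{\sigma}) = -\sum_{e=\{x,y\}\in E} J_e\sigma_x\sigma_y - \sum_{x\in\Lambda} h_x\sigma_x,\qquad \boldsymbol{\sigma}\in\{\pm1\}^{\Lambda}.$$ The partition function is $Z_{\mathbf{J},\mathbf{h}} = \sum_{\boldsymbol{\sigma}\in\{\pm1\}^\Lambda} \exp(-H_{\mathbf{J},\mathbf{h}}(\boldsymbol{\sigma}))$, the Gibbs measure is $\mu_{\mathbf{J},\mathbf{h}}(\boldsymbol{\sigma}) = \exp(-H_{\mathbf{J},\mathbf{h}}(\boldsymbol{\sigma}))/Z_{\mathbf{J},\mathbf{h}}$, and $\operatorname{cov}_{\mathbf{J},\mathbf{h}}$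 denotes covariance under $\mu_{\mathbf{J},\mathbf{h}}$. Write $|\mathbf{J}| = \{|J_e|\}_{e\in E}$ and $|\mathbf{h}| = \{|h_x|\}_{x\in\Lambda}$. *)

theory Defs
  imports "HOL-Probability.Probability"
begin

definition finite_graph :: "'a set \<Rightarrow> 'a set set \<Rightarrow> bool" where
  "finite_graph V E \<longleftrightarrow> finite V \<and> (\<forall>e\<in>E. e \<subseteq> V \<and> card e = 2)"

(* The extensional function space makes each configuration occur exactly once: off V a
   configuration takes the fixed value undefined. *)
definition spin_configs :: "'a set \<Rightarrow> ('a \<Rightarrow> real) set" where
  "spin_configs V = V \<rightarrow>\<^sub>E {-1, 1}"

(* For e = {x, y} with x and y distinct, the product over e is \<sigma> x * \<sigma> y. *)
definition ising_hamiltonian ::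
  "'a set \<Rightarrow> 'a set set \<Rightarrow> ('a set \<Rightarrow> real) \<Rightarrow> ('a \<Rightarrow> real) \<Rightarrow> ('a \<Rightarrow> real) \<Rightarrow> real" where
  "ising_hamiltonian V E J h \<sigma> = - (\<Sum>e\<in>E. J e * (\<Prod>x\<in>e. \<sigma> x)) - (\<Sum>x\<in>V. h x * \<sigma> x)"

definition ising_Z ::
  "'a set \<Rightarrow> 'a set set \<Rightarrow> ('a set \<Rightarrow> real) \<Rightarrow> ('a \<Rightarrow> real) \<Rightarrow> real" where
  "ising_Z V E J h = (\<Sum>\<sigma>\<in>spin_configs V. exp (- ising_hamiltonian V E J h \<sigma>))"

definition ising_gibbs ::
  "'a set \<Rightarrow> 'a set set \<Rightarrow> ('a set \<Rightarrow> real) \<Rightarrow> ('a \<Rightarrow> real) \<Rightarrow> ('a \<Rightarrow> real) measure" where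
  "ising_gibbs V E J h =
     point_measure (spin_configs V)
       (\<lambda>\<sigma>. ennreal (exp (- ising_hamiltonian V E J h \<sigma>) / ising_Z V E J h))"

definition covariance :: "'b measure \<Rightarrow> ('b \<Rightarrow> real) \<Rightarrow> ('b \<Rightarrow> real) \<Rightarrow> real" where
  "covariance M X Y =
     (\<integral>\<omega>. (X \<omega> - (\<integral>\<omega>'. X \<omega>' \<partial>M)) * (Y \<omega> - (\<integral>\<omega>'. Y \<omega>' \<partial>M)) \<partial>M)"

lemma finite_spin_configs: "finite V \<Longrightarrow> finite (spin_configs V)"
  unfolding spin_configs_def by (rule finite_PiE) auto

lemma spin_configs_nonempty: "spin_configs V \<noteq> {}"
  by (simp add: spin_configs_def PiE_eq_empty_iff)

lemma ising_Z_pos: "finite V \<Longrightarrow> ising_Z V E J h > 0"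
  unfolding ising_Z_def
  by (rule sum_pos) (simp_all add: finite_spin_configs spin_configs_nonempty)

lemma prob_space_ising_gibbs:
  assumes "finite V"
  shows "prob_space (ising_gibbs V E J h)"
proof
  have Z: "ising_Z V E J h > 0"
    by (rule ising_Z_pos[OF assms])
  have "(\<Sum>\<sigma>\<in>spin_configs V. exp (- ising_hamiltonian V E J h \<sigma>) / ising_Z V E J h) = 1"
    using Z by (simp add: ising_Z_def flip: sum_divide_distrib)
  then show "emeasure (ising_gibbs V E J h) (space (ising_gibbs V E J h)) = 1"
    using Z assms
    by (simp add: ising_gibbs_def space_point_measure emeasure_point_measure_finite
        finite_spin_configs sum_ennreal)
qed

end

theory Submission
  imports Defs
begin

text \<open>
  The proof is Ginibre's duplication argument. Take two independent copies \<open>\<sigma>\<close> and \<open>\<tau>\<close> of the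
  system. The symmetrised form of the covariance is
  \<open>2 Z\<^sup>2 cov(\<sigma>\<^sub>i, \<sigma>\<^sub>j) = \<Sum>\<^sub>\<sigma> \<Sum>\<^sub>\<tau> (\<sigma>\<^sub>i - \<tau>\<^sub>i)(\<sigma>\<^sub>j - \<tau>\<^sub>j) exp(- H(\<sigma>) - H(\<tau>))\<close>
  (\<open>covariance_ising_gibbs\<close>), so the claim compares the double sum for \<open>(J, h)\<close> with the one for \<open>(|J|, |h|)\<close>.

  Put \<open>u\<^sub>x = \<sigma>\<^sub>x + \<tau>\<^sub>x\<close> and \<open>v\<^sub>x = \<sigma>\<^sub>x - \<tau>\<^sub>x\<close>. The prefactor and the exponent are polynomials
  with nonnegative coefficients in these variables and in the parameters, since
  \<open>\<sigma>\<^sub>x\<sigma>\<^sub>y + \<tau>\<^sub>x\<tau>\<^sub>y = (u\<^sub>xu\<^sub>y + v\<^sub>xv\<^sub>y)/2\<close>. Moreover every monomial in \<open>u\<close> and \<open>v\<close> has a nonnegative sum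
  over all pairs of configurations (\<open>sum_ginibre_monomial_nonneg\<close>): the sum factorises over the
  sites, and at one site \<open>u\<close> and \<open>v\<close> are symmetric and never both nonzero. Hence the double sum is
  a power series in \<open>J\<close> and \<open>h\<close> with nonnegative coefficients, and replacing the parameters by their
  absolute values can only increase its absolute value.

  The last step is carried out without power series. The cone spanned by the monomials is closed
  under products, and \<open>f\<close> is called dominated by \<open>g\<close> if both \<open>g - f\<close> and \<open>g + f\<close> lie in the cone.
  Domination is multiplicative (\<open>ginibre_dominated_mult\<close>), and each Boltzmann factor for \<open>(J, h)\<close> is
  dominated by the corresponding factor for \<open>(|J|, |h|)\<close> (\<open>ginibre_dominated_exp\<close>), since its exponent
  is the parameter times a function with values \<open>-2\<close>, \<open>0\<close>, \<open>2\<close>, and the exponential is therefore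
  a quadratic polynomial in this function.
\<close>

section \<open>The Ginibre cone of a duplicated spin system\<close>

definition ginibre_monomial ::
  "'a set \<Rightarrow> ('a \<Rightarrow> nat) \<Rightarrow> ('a \<Rightarrow> nat) \<Rightarrow> ('a \<Rightarrow> real) \<Rightarrow> ('a \<Rightarrow> real) \<Rightarrow> real" where
  "ginibre_monomial V a b \<sigma> \<tau> = (\<Prod>x\<in>V. (\<sigma> x + \<tau> x) ^ a x * (\<sigma> x - \<tau> x) ^ b x)"

text \<open>
  Membership depends only on the values at pairs of spin configurations (rule \<open>cong\<close>), because the
  quadratic formula for a Boltzmann factor holds only there.
\<close>

inductive_set ginibre_cone :: "'a set \<Rightarrow> (('a \<Rightarrow> real) \<Rightarrow> ('a \<Rightarrow> real) \<Rightarrow> real) set"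
  for V :: "'a set" where
  monomial: "c \<ge> 0 \<Longrightarrow> (\<lambda>\<sigma> \<tau>. c * ginibre_monomial V a b \<sigma> \<tau>) \<in> ginibre_cone V"
| add: "f \<in> ginibre_cone V \<Longrightarrow> g \<in> ginibre_cone V \<Longrightarrow> (\<lambda>\<sigma> \<tau>. f \<sigma> \<tau> + g \<sigma> \<tau>) \<in> ginibre_cone V"
| cong: "f \<in> ginibre_cone V \<Longrightarrow>
    (\<And>\<sigma> \<tau>. \<sigma> \<in> spin_configs V \<Longrightarrow> \<tau> \<in> spin_configs V \<Longrightarrow> g \<sigma> \<tau> = f \<sigma> \<tau>) \<Longrightarrow>
    g \<in> ginibre_cone V"

lemma ginibre_monomial_mult:
  "ginibre_monomial V a b \<sigma> \<tau> * ginibre_monomial V a' b' \<sigma> \<tau> =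
    ginibre_monomial V (\<lambda>x. a x + a' x) (\<lambda>x. b x + b' x) \<sigma> \<tau>"
  by (simp add: ginibre_monomial_def power_add mult_ac flip: prod.distrib)

lemma ginibre_cone_mult:
  assumes "f \<in> ginibre_cone V" and "g \<in> ginibre_cone V"
  shows "(\<lambda>\<sigma> \<tau>. f \<sigma> \<tau> * g \<sigma> \<tau>) \<in> ginibre_cone V"
  using assms(1)
proof induction
  case (monomial c a b)
  from assms(2) show ?case
  proof induction
    case (monomial c' a' b')
    have "(\<lambda>\<sigma> \<tau>. (c * c') * ginibre_monomial V (\<lambda>x. a x + a' x) (\<lambda>x. b x + b' x) \<sigma> \<tau>)
        \<in> ginibre_cone V"
      using \<open>0 \<le> c\<close> \<open>0 \<le> c'\<close> by (intro ginibre_cone.monomial) simp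
    then show ?case
      by (simp add: mult_ac flip: ginibre_monomial_mult)
  next
    case (add f g)
    then show ?case
      by (simp add: distrib_left ginibre_cone.add)
  next
    case (cong f g)
    from cong.IH show ?case
      by (rule ginibre_cone.cong) (simp add: cong.hyps)
  qed
next
  case (add f f')
  then show ?case
    by (simp add: distrib_right ginibre_cone.add)
next
  case (cong f f')
  from cong.IH show ?case
    by (rule ginibre_cone.cong) (simp add: cong.hyps)
qed

lemma ginibre_cone_const: "c \<ge> 0 \<Longrightarrow> (\<lambda>\<sigma> \<tau>. c) \<in> ginibre_cone V"
  using ginibre_cone.monomial[of c V "\<lambda>_. 0" "\<lambda>_. 0"] by (simp add: ginibre_monomial_def)

lemma ginibre_cone_scale:
  "c \<ge> 0 \<Longrightarrow> f \<in> ginibre_cone V \<Longrightarrow> (\<lambda>\<sigma> \<tau>. c * f \<sigma> \<tau>) \<in> ginibre_cone V"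
  by (rule ginibre_cone_mult[OF ginibre_cone_const])

lemma ginibre_cone_spin_add:
  assumes "finite V" and "x \<in> V"
  shows "(\<lambda>\<sigma> \<tau>. \<sigma> x + \<tau> x) \<in> ginibre_cone V"
proof -
  have "ginibre_monomial V (\<lambda>y. if y = x then 1 else 0) (\<lambda>_. 0) = (\<lambda>\<sigma> \<tau>. \<sigma> x + \<tau> x)"
    using assms by (simp add: fun_eq_iff ginibre_monomial_def if_distrib[of "\<lambda>n. _ ^ n"] cong: if_cong)
  then show ?thesis
    using ginibre_cone.monomial[of 1 V "\<lambda>y. if y = x then 1 else 0" "\<lambda>_. 0"] by simp
qed

lemma ginibre_cone_spin_diff:
  assumes "finite V" and "x \<in> V"
  shows "(\<lambda>\<sigma> \<tau>. \<sigma> x - \<tau> x) \<in> ginibre_cone V"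
proof -
  have "ginibre_monomial V (\<lambda>_. 0) (\<lambda>y. if y = x then 1 else 0) = (\<lambda>\<sigma> \<tau>. \<sigma> x - \<tau> x)"
    using assms by (simp add: fun_eq_iff ginibre_monomial_def if_distrib[of "\<lambda>n. _ ^ n"] cong: if_cong)
  then show ?thesis
    using ginibre_cone.monomial[of 1 V "\<lambda>_. 0" "\<lambda>y. if y = x then 1 else 0"] by simp
qed

text \<open>
  The edge interaction of the two copies together is \<open>(u\<^sub>xu\<^sub>y + v\<^sub>xv\<^sub>y)/2\<close>; this identity is the reason
  for passing to sums and differences of spins.
\<close>

lemma ginibre_cone_edge:
  assumes "finite V" and "e \<subseteq> V" and "card e = 2"
  shows "(\<lambda>\<sigma> \<tau>. (\<Prod>x\<in>e. \<sigma> x) + (\<Prod>x\<in>e. \<tau> x)) \<in> ginibre_cone V"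
proof -
  obtain x y where e: "e = {x, y}" and "x \<noteq> y"
    using assms(3) by (meson card_2_iff)
  then have xy: "x \<in> V" "y \<in> V"
    using assms(2) by auto
  have "(\<lambda>\<sigma> \<tau>. 1/2 * ((\<sigma> x + \<tau> x) * (\<sigma> y + \<tau> y) + (\<sigma> x - \<tau> x) * (\<sigma> y - \<tau> y))) \<in> ginibre_cone V"
    by (intro ginibre_cone_scale ginibre_cone.add ginibre_cone_mult ginibre_cone_spin_add
        ginibre_cone_spin_diff assms(1) xy) simp
  also have "(\<lambda>\<sigma> \<tau>. 1/2 * ((\<sigma> x + \<tau> x) * (\<sigma> y + \<tau> y) + (\<sigma> x - \<tau> x) * (\<sigma> y - \<tau> y)))
      = (\<lambda>\<sigma> \<tau>. (\<Prod>x\<in>e. \<sigma> x) + (\<Prod>x\<in>e. \<tau> x) :: real)"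
    using \<open>x \<noteq> y\<close> by (simp add: e fun_eq_iff field_simps)
  finally show ?thesis .
qed

section \<open>Positivity of sums over pairs of configurations\<close>

text \<open>
  Of the four terms, those with \<open>s = t\<close> contribute \<open>2\<^sup>a + (-2)\<^sup>a\<close> if \<open>b = 0\<close> and nothing otherwise, and
  those with \<open>s = -t\<close> contribute \<open>2\<^sup>b + (-2)\<^sup>b\<close> if \<open>a = 0\<close> and nothing otherwise.
\<close>

lemma sum_ginibre_site_nonneg:
  "(\<Sum>s\<in>{-1, 1}. \<Sum>t\<in>{-1, 1}. (s + t) ^ a * (s - t) ^ b) \<ge> (0 :: real)"
proof -
  have pow: "(-2 :: real) ^ n + 2 ^ n \<ge> 0" for n
    by (cases "even n") simp_all
  have "(\<Sum>s\<in>{-1, 1}. \<Sum>t\<in>{-1, 1}. (s + t) ^ a * (s - t) ^ b)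
      = ((-2) ^ a + 2 ^ a) * 0 ^ b + 0 ^ a * ((-2) ^ b + 2 ^ b :: real)"
    by (simp add: algebra_simps)
  also have "\<dots> \<ge> 0"
    by (intro add_nonneg_nonneg mult_nonneg_nonneg pow) simp_all
  finally show ?thesis .
qed

lemma sum_ginibre_monomial_nonneg:
  assumes "finite V"
  shows "(\<Sum>\<sigma>\<in>spin_configs V. \<Sum>\<tau>\<in>spin_configs V. ginibre_monomial V a b \<sigma> \<tau>) \<ge> 0"
proof -
  define F where "F x s t = (s + t) ^ a x * (s - t) ^ b x" for x and s t :: real
  have "(\<Sum>\<sigma>\<in>spin_configs V. \<Sum>\<tau>\<in>spin_configs V. ginibre_monomial V a b \<sigma> \<tau>)
      = (\<Sum>\<sigma>\<in>spin_configs V. \<Prod>x\<in>V. \<Sum>t\<in>{-1, 1}. F x (\<sigma> x) t)"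
    unfolding spin_configs_def ginibre_monomial_def F_def
    by (intro sum.cong refl prod_sum_PiE[symmetric]) (simp_all add: assms)
  also have "\<dots> = (\<Prod>x\<in>V. \<Sum>s\<in>{-1, 1}. \<Sum>t\<in>{-1, 1}. F x s t)"
    unfolding spin_configs_def by (intro prod_sum_PiE[symmetric]) (simp_all add: assms)
  also have "\<dots> \<ge> 0"
    unfolding F_def by (intro prod_nonneg ballI sum_ginibre_site_nonneg)
  finally show ?thesis .
qed

lemma sum_ginibre_cone_nonneg:
  assumes "f \<in> ginibre_cone V" and "finite V"
  shows "(\<Sum>\<sigma>\<in>spin_configs V. \<Sum>\<tau>\<in>spin_configs V. f \<sigma> \<tau>) \<ge> 0"
  using assms(1)
proof induction
  case (monomial c a b)
  then show ?case
    using sum_ginibre_monomial_nonneg[OF assms(2)] by (simp flip: sum_distrib_left)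
next
  case (add f g)
  then show ?case by (simp add: sum.distrib)
next
  case (cong f g)
  then show ?case by simp
qed

section \<open>Domination of Boltzmann factors\<close>

definition ginibre_dominated ::
  "'a set \<Rightarrow> (('a \<Rightarrow> real) \<Rightarrow> ('a \<Rightarrow> real) \<Rightarrow> real) \<Rightarrow> (('a \<Rightarrow> real) \<Rightarrow> ('a \<Rightarrow> real) \<Rightarrow> real) \<Rightarrow> bool" where
  "ginibre_dominated V f g \<longleftrightarrow>
    (\<lambda>\<sigma> \<tau>. g \<sigma> \<tau> - f \<sigma> \<tau>) \<in> ginibre_cone V \<and> (\<lambda>\<sigma> \<tau>. g \<sigma> \<tau> + f \<sigma> \<tau>) \<in> ginibre_cone V"

lemma ginibre_dominated_refl: "f \<in> ginibre_cone V \<Longrightarrow> ginibre_dominated V f f"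
  using ginibre_cone.add[of f V f] by (simp add: ginibre_dominated_def ginibre_cone_const)

text \<open>
  This is the identity \<open>2(gg' \<minusplus> ff') = (g - f)(g' \<plusminus> f') + (g + f)(g' \<minusplus> f')\<close>.
\<close>

lemma ginibre_dominated_mult:
  assumes "ginibre_dominated V f g" and "ginibre_dominated V f' g'"
  shows "ginibre_dominated V (\<lambda>\<sigma> \<tau>. f \<sigma> \<tau> * f' \<sigma> \<tau>) (\<lambda>\<sigma> \<tau>. g \<sigma> \<tau> * g' \<sigma> \<tau>)"
proof -
  have fg: "(\<lambda>\<sigma> \<tau>. g \<sigma> \<tau> - f \<sigma> \<tau>) \<in> ginibre_cone V" "(\<lambda>\<sigma> \<tau>. g \<sigma> \<tau> + f \<sigma> \<tau>) \<in> ginibre_cone V"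
    and fg': "(\<lambda>\<sigma> \<tau>. g' \<sigma> \<tau> - f' \<sigma> \<tau>) \<in> ginibre_cone V" "(\<lambda>\<sigma> \<tau>. g' \<sigma> \<tau> + f' \<sigma> \<tau>) \<in> ginibre_cone V"
    using assms by (simp_all add: ginibre_dominated_def)
  have "(\<lambda>\<sigma> \<tau>. 1/2 * ((g \<sigma> \<tau> - f \<sigma> \<tau>) * (g' \<sigma> \<tau> + f' \<sigma> \<tau>) + (g \<sigma> \<tau> + f \<sigma> \<tau>) * (g' \<sigma> \<tau> - f' \<sigma> \<tau>)))
      \<in> ginibre_cone V"
    "(\<lambda>\<sigma> \<tau>. 1/2 * ((g \<sigma> \<tau> - f \<sigma> \<tau>) * (g' \<sigma> \<tau> - f' \<sigma> \<tau>) + (g \<sigma> \<tau> + f \<sigma> \<tau>) * (g' \<sigma> \<tau> + f' \<sigma> \<tau>)))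
      \<in> ginibre_cone V"
    by (rule ginibre_cone_scale, simp, intro ginibre_cone.add fg[THEN ginibre_cone_mult] fg')+
  then show ?thesis
    unfolding ginibre_dominated_def by (simp add: algebra_simps add_divide_distrib diff_divide_distrib)
qed

lemma ginibre_dominated_prod:
  assumes "\<And>k. k \<in> K \<Longrightarrow> ginibre_dominated V (f k) (g k)"
  shows "ginibre_dominated V (\<lambda>\<sigma> \<tau>. \<Prod>k\<in>K. f k \<sigma> \<tau>) (\<lambda>\<sigma> \<tau>. \<Prod>k\<in>K. g k \<sigma> \<tau>)"
  using assms
proof (induction K rule: infinite_finite_induct)
  case (insert k K)
  then show ?case
    by (simp add: ginibre_dominated_mult)
qed (simp_all add: ginibre_dominated_refl ginibre_cone_const)

lemma ginibre_dominated_sum_le: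
  assumes "ginibre_dominated V f g" and "finite V"
  shows "\<bar>\<Sum>\<sigma>\<in>spin_configs V. \<Sum>\<tau>\<in>spin_configs V. f \<sigma> \<tau>\<bar>
    \<le> (\<Sum>\<sigma>\<in>spin_configs V. \<Sum>\<tau>\<in>spin_configs V. g \<sigma> \<tau>)"
proof -
  have "(\<lambda>\<sigma> \<tau>. g \<sigma> \<tau> - f \<sigma> \<tau>) \<in> ginibre_cone V" "(\<lambda>\<sigma> \<tau>. g \<sigma> \<tau> + f \<sigma> \<tau>) \<in> ginibre_cone V"
    using assms(1) by (simp_all add: ginibre_dominated_def)
  from this[THEN sum_ginibre_cone_nonneg, OF assms(2)] show ?thesis
    by (simp add: sum.distrib sum_subtractf abs_le_iff)
qed

text \<open>Interpolation of \<open>exp\<close> at the three points; it replaces the full exponential series.\<close>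

lemma exp_three_point:
  assumes "A \<in> {-2, 0, 2 :: real}"
  shows "exp (t * A) = 1 + sinh (2 * t) / 2 * A + (cosh (2 * t) - 1) / 4 * A\<^sup>2"
  using assms by (auto simp: sinh_field_def cosh_field_def field_simps exp_minus)

text \<open>
  In the quadratic formula the coefficient of \<open>A\<close> is odd and increasing in \<open>t\<close>, and the coefficient
  of \<open>A\<^sup>2\<close> is even and nonnegative, so each coefficient at \<open>t\<close> is bounded in absolute value by the
  one at \<open>|t|\<close>.
\<close>

lemma ginibre_dominated_exp:
  assumes A: "A \<in> ginibre_cone V"
    and vals: "\<And>\<sigma> \<tau>. \<sigma> \<in> spin_configs V \<Longrightarrow> \<tau> \<in> spin_configs V \<Longrightarrow> A \<sigma> \<tau> \<in> {-2, 0, 2}"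
  shows "ginibre_dominated V (\<lambda>\<sigma> \<tau>. exp (t * A \<sigma> \<tau>)) (\<lambda>\<sigma> \<tau>. exp (\<bar>t\<bar> * A \<sigma> \<tau>))"
proof -
  have poly: "(\<lambda>\<sigma> \<tau>. p + q * A \<sigma> \<tau> + r * (A \<sigma> \<tau> * A \<sigma> \<tau>)) \<in> ginibre_cone V"
    if "p \<ge> 0" "q \<ge> 0" "r \<ge> 0" for p q r
    using that by (intro ginibre_cone.add ginibre_cone_scale ginibre_cone_mult ginibre_cone_const A)
  have s: "\<bar>sinh (2 * t)\<bar> \<le> sinh (2 * \<bar>t\<bar>)"
    by (cases "t \<ge> 0") simp_all
  have c: "cosh (2 * \<bar>t\<bar>) = cosh (2 * t)"
    by (cases "t \<ge> 0") simp_all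
  have c1: "cosh (2 * t) \<ge> 1"
    by (rule cosh_real_ge_1)
  have "(\<lambda>\<sigma> \<tau>. exp (\<bar>t\<bar> * A \<sigma> \<tau>) - exp (t * A \<sigma> \<tau>)) \<in> ginibre_cone V"
  proof (rule ginibre_cone.cong[OF poly])
    show "exp (\<bar>t\<bar> * A \<sigma> \<tau>) - exp (t * A \<sigma> \<tau>) = 0 + (sinh (2 * \<bar>t\<bar>) - sinh (2 * t)) / 2 * A \<sigma> \<tau>
        + 0 * (A \<sigma> \<tau> * A \<sigma> \<tau>)" if "\<sigma> \<in> spin_configs V" "\<tau> \<in> spin_configs V" for \<sigma> \<tau>
      unfolding exp_three_point[OF vals[OF that]] c by (simp add: algebra_simps diff_divide_distrib)
  qed (use s in auto)
  moreover have "(\<lambda>\<sigma> \<tau>. exp (\<bar>t\<bar> * A \<sigma> \<tau>) + exp (t * A \<sigma> \<tau>)) \<in> ginibre_cone V"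
  proof (rule ginibre_cone.cong[OF poly])
    show "exp (\<bar>t\<bar> * A \<sigma> \<tau>) + exp (t * A \<sigma> \<tau>) = 2 + (sinh (2 * \<bar>t\<bar>) + sinh (2 * t)) / 2 * A \<sigma> \<tau>
        + (cosh (2 * t) - 1) / 2 * (A \<sigma> \<tau> * A \<sigma> \<tau>)"
      if "\<sigma> \<in> spin_configs V" "\<tau> \<in> spin_configs V" for \<sigma> \<tau>
      unfolding exp_three_point[OF vals[OF that]] c by (simp add: field_simps power2_eq_square)
  qed (use s c1 in auto)
  ultimately show ?thesis
    by (simp add: ginibre_dominated_def)
qed

lemma spin_configs_prod:
  assumes "\<sigma> \<in> spin_configs V" and "e \<subseteq> V"
  shows "(\<Prod>x\<in>e. \<sigma> x) \<in> {-1, 1}"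
proof -
  have "\<bar>\<Prod>x\<in>e. \<sigma> x\<bar> = (\<Prod>x\<in>e. 1)"
    unfolding abs_prod using assms by (intro prod.cong) (fastforce simp: spin_configs_def PiE_iff)+
  then show ?thesis
    by auto
qed

lemma exp_duplicated_hamiltonian:
  assumes "finite V" and "finite E"
  shows "exp (- ising_hamiltonian V E J h \<sigma>) * exp (- ising_hamiltonian V E J h \<tau>)
    = (\<Prod>e\<in>E. exp (J e * ((\<Prod>x\<in>e. \<sigma> x) + (\<Prod>x\<in>e. \<tau> x)))) * (\<Prod>x\<in>V. exp (h x * (\<sigma> x + \<tau> x)))"
  using assms
  by (simp add: ising_hamiltonian_def distrib_left sum.distrib flip: exp_sum exp_add)

lemma ginibre_dominated_boltzmann:
  assumes "finite_graph V E"
  shows "ginibre_dominated V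
    (\<lambda>\<sigma> \<tau>. exp (- ising_hamiltonian V E J h \<sigma>) * exp (- ising_hamiltonian V E J h \<tau>))
    (\<lambda>\<sigma> \<tau>. exp (- ising_hamiltonian V E (\<lambda>e. \<bar>J e\<bar>) (\<lambda>x. \<bar>h x\<bar>) \<sigma>)
      * exp (- ising_hamiltonian V E (\<lambda>e. \<bar>J e\<bar>) (\<lambda>x. \<bar>h x\<bar>) \<tau>))"
proof -
  have V: "finite V" and E: "\<And>e. e \<in> E \<Longrightarrow> e \<subseteq> V \<and> card e = 2"
    using assms by (auto simp: finite_graph_def)
  have finE: "finite E"
    using V E by (meson PowI finite_Pow_iff finite_subset subsetI)
  have "ginibre_dominated V (\<lambda>\<sigma> \<tau>. exp (J e * ((\<Prod>x\<in>e. \<sigma> x) + (\<Prod>x\<in>e. \<tau> x))))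
      (\<lambda>\<sigma> \<tau>. exp (\<bar>J e\<bar> * ((\<Prod>x\<in>e. \<sigma> x) + (\<Prod>x\<in>e. \<tau> x))))" if "e \<in> E" for e
  proof (rule ginibre_dominated_exp[OF ginibre_cone_edge])
    show "(\<Prod>x\<in>e. \<sigma> x) + (\<Prod>x\<in>e. \<tau> x) \<in> {-2, 0, 2}"
      if "\<sigma> \<in> spin_configs V" "\<tau> \<in> spin_configs V" for \<sigma> \<tau>
      using that[THEN spin_configs_prod, of e] E[OF \<open>e \<in> E\<close>] by auto
  qed (use V E[OF that] in auto)
  moreover have "ginibre_dominated V (\<lambda>\<sigma> \<tau>. exp (h x * (\<sigma> x + \<tau> x)))
      (\<lambda>\<sigma> \<tau>. exp (\<bar>h x\<bar> * (\<sigma> x + \<tau> x)))" if "x \<in> V" for x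
  proof (rule ginibre_dominated_exp[OF ginibre_cone_spin_add])
    show "\<sigma> x + \<tau> x \<in> {-2, 0, 2}" if "\<sigma> \<in> spin_configs V" "\<tau> \<in> spin_configs V" for \<sigma> \<tau>
      using that[THEN spin_configs_prod, of "{x}"] \<open>x \<in> V\<close> by auto
  qed (use V that in auto)
  ultimately show ?thesis
    unfolding exp_duplicated_hamiltonian[OF V finE]
    by (intro ginibre_dominated_mult ginibre_dominated_prod)
qed

section \<open>The covariance as a double sum\<close>

text \<open>
  For independent copies \<open>(X, Y)\<close> and \<open>(X', Y')\<close>, the product \<open>(X - X')(Y - Y')\<close> has expectation
  \<open>2 cov(X, Y)\<close>: the unmixed terms give \<open>2 E(XY)\<close> and the mixed ones \<open>-2 E(X) E(Y)\<close>.
\<close>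

lemma sum_covariance_symmetrised:
  fixes p X Y :: "'b \<Rightarrow> real"
  assumes "(\<Sum>s\<in>S. p s) = 1"
  shows "2 * (\<Sum>s\<in>S. p s * ((X s - (\<Sum>t\<in>S. p t * X t)) * (Y s - (\<Sum>t\<in>S. p t * Y t))))
    = (\<Sum>s\<in>S. \<Sum>t\<in>S. (X s - X t) * (Y s - Y t) * (p s * p t))"
proof -
  define mX where "mX = (\<Sum>t\<in>S. p t * X t)"
  define mY where "mY = (\<Sum>t\<in>S. p t * Y t)"
  define mXY where "mXY = (\<Sum>t\<in>S. p t * (X t * Y t))"
  have "(\<Sum>s\<in>S. p s * ((X s - mX) * (Y s - mY)))
      = (\<Sum>s\<in>S. p s * (X s * Y s) - p s * X s * mY - p s * Y s * mX + p s * (mX * mY))"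
    by (intro sum.cong) (simp_all add: algebra_simps)
  also have "\<dots> = mXY - mX * mY"
    unfolding sum.distrib sum_subtractf
    by (simp add: assms mX_def[symmetric] mY_def[symmetric] mXY_def[symmetric] flip: sum_distrib_right)
  finally have l: "(\<Sum>s\<in>S. p s * ((X s - mX) * (Y s - mY))) = mXY - mX * mY" .
  have "(\<Sum>s\<in>S. \<Sum>t\<in>S. (X s - X t) * (Y s - Y t) * (p s * p t))
      = (\<Sum>s\<in>S. \<Sum>t\<in>S. (p s * (X s * Y s)) * p t - (p s * X s) * (p t * Y t)
          - (p s * Y s) * (p t * X t) + p s * (p t * (X t * Y t)))"
    by (intro sum.cong) (simp_all add: algebra_simps)
  also have "\<dots> = 2 * (mXY - mX * mY)"
    unfolding sum.distrib sum_subtractf sum_product[symmetric]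
    by (simp add: assms mX_def[symmetric] mY_def[symmetric] mXY_def[symmetric])
  finally show ?thesis
    using l by (simp add: mX_def mY_def)
qed

lemma covariance_ising_gibbs:
  assumes "finite V"
  shows "2 * (ising_Z V E J h)\<^sup>2 * covariance (ising_gibbs V E J h) X Y
    = (\<Sum>\<sigma>\<in>spin_configs V. \<Sum>\<tau>\<in>spin_configs V. (X \<sigma> - X \<tau>) * (Y \<sigma> - Y \<tau>)
        * (exp (- ising_hamiltonian V E J h \<sigma>) * exp (- ising_hamiltonian V E J h \<tau>)))"
proof -
  let ?S = "spin_configs V"
  let ?w = "\<lambda>\<sigma>. exp (- ising_hamiltonian V E J h \<sigma>)"
  define Z where "Z = ising_Z V E J h"
  define p where "p \<sigma> = ?w \<sigma> / Z" for \<sigma>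
  have Z: "Z > 0"
    unfolding Z_def by (rule ising_Z_pos[OF assms])
  have int: "(\<integral>\<sigma>. f \<sigma> \<partial>ising_gibbs V E J h) = (\<Sum>\<sigma>\<in>?S. p \<sigma> * f \<sigma>)" for f :: "_ \<Rightarrow> real"
    using Z unfolding ising_gibbs_def p_def Z_def
    by (subst lebesgue_integral_point_measure_finite) (simp_all add: assms finite_spin_configs)
  have p1: "(\<Sum>\<sigma>\<in>?S. p \<sigma>) = 1"
    using Z unfolding p_def Z_def by (simp add: ising_Z_def flip: sum_divide_distrib)
  have "2 * covariance (ising_gibbs V E J h) X Y
      = (\<Sum>\<sigma>\<in>?S. \<Sum>\<tau>\<in>?S. (X \<sigma> - X \<tau>) * (Y \<sigma> - Y \<tau>) * (p \<sigma> * p \<tau>))"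
    unfolding covariance_def int by (rule sum_covariance_symmetrised[OF p1])
  then have "2 * Z\<^sup>2 * covariance (ising_gibbs V E J h) X Y
      = (\<Sum>\<sigma>\<in>?S. \<Sum>\<tau>\<in>?S. Z\<^sup>2 * ((X \<sigma> - X \<tau>) * (Y \<sigma> - Y \<tau>) * (p \<sigma> * p \<tau>)))"
    unfolding sum_distrib_left[symmetric] by simp
  also have "\<dots> = (\<Sum>\<sigma>\<in>?S. \<Sum>\<tau>\<in>?S. (X \<sigma> - X \<tau>) * (Y \<sigma> - Y \<tau>) * (?w \<sigma> * ?w \<tau>))"
    using Z by (intro sum.cong refl) (simp add: p_def power2_eq_square)
  finally show ?thesis
    by (simp add: Z_def)
qed

theorem lemma1p4:
  fixes V :: "'a set" and E :: "'a set set"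
    and J :: "'a set \<Rightarrow> real" and h :: "'a \<Rightarrow> real" and i j :: 'a
  assumes "finite_graph V E" and "i \<in> V" and "j \<in> V"
  shows "\<bar>covariance (ising_gibbs V E J h) (\<lambda>\<sigma>. \<sigma> i) (\<lambda>\<sigma>. \<sigma> j)\<bar>
    \<le> covariance (ising_gibbs V E (\<lambda>e. \<bar>J e\<bar>) (\<lambda>x. \<bar>h x\<bar>)) (\<lambda>\<sigma>. \<sigma> i) (\<lambda>\<sigma>. \<sigma> j)
      * (ising_Z V E (\<lambda>e. \<bar>J e\<bar>) (\<lambda>x. \<bar>h x\<bar>) / ising_Z V E J h)\<^sup>2"
proof -
  have V: "finite V"
    using assms(1) by (simp add: finite_graph_def)
  define Z where "Z = ising_Z V E J h"
  define Z' where "Z' = ising_Z V E (\<lambda>e. \<bar>J e\<bar>) (\<lambda>x. \<bar>h x\<bar>)"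
  define C where "C = covariance (ising_gibbs V E J h) (\<lambda>\<sigma>. \<sigma> i) (\<lambda>\<sigma>. \<sigma> j)"
  define C' where "C' = covariance (ising_gibbs V E (\<lambda>e. \<bar>J e\<bar>) (\<lambda>x. \<bar>h x\<bar>)) (\<lambda>\<sigma>. \<sigma> i) (\<lambda>\<sigma>. \<sigma> j)"
  have Z: "Z > 0"
    unfolding Z_def by (rule ising_Z_pos[OF V])
  have "ginibre_dominated V (\<lambda>\<sigma> \<tau>. (\<sigma> i - \<tau> i) * (\<sigma> j - \<tau> j)) (\<lambda>\<sigma> \<tau>. (\<sigma> i - \<tau> i) * (\<sigma> j - \<tau> j))"
    by (intro ginibre_dominated_refl ginibre_cone_mult ginibre_cone_spin_diff V assms)
  from ginibre_dominated_sum_le[OF ginibre_dominated_mult[OF this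
        ginibre_dominated_boltzmann[OF assms(1), of J h]] V]
  have "\<bar>2 * Z\<^sup>2 * C\<bar> \<le> 2 * Z'\<^sup>2 * C'"
    unfolding Z_def Z'_def C_def C'_def covariance_ising_gibbs[OF V] .
  then have "Z\<^sup>2 * \<bar>C\<bar> \<le> Z'\<^sup>2 * C'"
    by (simp add: abs_mult)
  then have "\<bar>C\<bar> \<le> C' * (Z' / Z)\<^sup>2"
    using Z by (simp add: power_divide field_simps)
  then show ?thesis
    unfolding Z_def Z'_def C_def C'_def .
qed

end
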